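(* Let $p$ be a subharmonic function on $\mathbb{C}$ satisfying the standing assumptions (1) and (2) stated in the context. An entire function $f:\mathbb{C}\to\mathbb{C}$ belongs to the space $A_p(\mathbb{C})$ if and only if $f$ belongs to $\mathfrak{H}_p(\mathbb{C})$. In other words, as sets, $A_p(\mathbb{C})=\mathfrak{H}_p(\mathbb{C})$.
   Context: Standing assumptions on $p$: (1) $p(z)\ge 0$ and $\log(1+|z|^2)=O(p(z))$, i.e. there is $M>0$ with $\log(1+|z|^2)\le M p(z)$ for all $z$; (2) there exist constants $C,D>0$ such that $|z-w|\le 1$ implies $p(z)\le Cp(w)+D$. $H(\mathbb{C})$ is the space of entire functions and $d\lambda$ is Lebesgue measure on $\mathbb{C}$. Define $$A_p(\mathbb{C})=\{f\in H(\mathbb{C}):\ \exists A,B>0\ \text{such that } |f(z)|\le A\exp(Bp(z))\ \text{for all } z\in\mathbb{C}\},$$ and let $\mathfrak{H}_p(\mathbb{C})$ be the set of all entire functions $f$ such that there exists a constant $C>0$ with $$\int_{\mathbb{C}}\frac{|f(z)|^2}{(1+|z|^2)^2}e^{-Cp(z)}\,d\lambda(z)<+\infty.$$ *)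

theory Defs
  imports "HOL-Complex_Analysis.Complex_Analysis"
begin

text \<open>
  Subharmonicity on the whole plane, for functions with real values (the value minus infinity, which
  is allowed in general, is excluded for the nonnegative weights considered here): upper
  semicontinuity together with the submean inequality over all circles.
  For real-valued \<open>u\<close> the inequality with a circle mean in \<open>[-\<infinity>, \<infinity>)\<close> forces
  that mean to be finite, so integrability is part of the usual definition; it has to be stated
  here because the library assigns the value 0 to the integral of a non-integrable function.
\<close>

definition upper_semicontinuous :: "('a::topological_space \<Rightarrow> real) \<Rightarrow> bool" where
  "upper_semicontinuous u \<longleftrightarrow> (\<forall>a. open {z. u z < a})"

definition subharmonic :: "(complex \<Rightarrow> real) \<Rightarrow> bool" where
  "subharmonic u \<longleftrightarrow>
     upper_semicontinuous u \<and>
     (\<forall>z. \<forall>r>0.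
        set_integrable lborel {0..2 * pi} (\<lambda>t. u (z + of_real r * cis t)) \<and>
        u z \<le> 1 / (2 * pi) * (LINT t:{0..2 * pi}|lborel. u (z + of_real r * cis t)))"

definition A_space :: "(complex \<Rightarrow> real) \<Rightarrow> (complex \<Rightarrow> complex) set" where
  "A_space p =
     {f. f holomorphic_on UNIV \<and>
         (\<exists>A>0. \<exists>B>0. \<forall>z. cmod (f z) \<le> A * exp (B * p z))}"

definition H_space :: "(complex \<Rightarrow> real) \<Rightarrow> (complex \<Rightarrow> complex) set" where
  "H_space p =
     {f. f holomorphic_on UNIV \<and>
         (\<exists>C>0. (\<integral>\<^sup>+ z. ennreal ((cmod (f z))\<^sup>2 / (1 + (cmod z)\<^sup>2)\<^sup>2 * exp (- C * p z)) \<partial>lborel) < \<infinity>)}"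

end

theory Submission
  imports Defs "HOL-Probability.Sinc_Integral"
begin

text \<open>
  If \<open>\<bar>f\<bar> \<le> A exp (B p)\<close>, then with the exponent \<open>C = 2 B\<close> the weighted integrand is at most
  \<open>A\<^sup>2 / (1 + \<bar>z\<bar>\<^sup>2)\<^sup>2\<close>, which is integrable over the plane. Conversely, \<open>\<bar>f z\<bar>\<^sup>2\<close> is bounded by the mean of
  \<open>\<bar>f\<bar>\<^sup>2\<close> over the unit disc around \<open>z\<close>, and on this disc the weight
  \<open>(1 + \<bar>w\<bar>\<^sup>2)\<^sup>2 exp (c p w)\<close> is at most \<open>exp ((2 M + c) p w)\<close>, hence at most
  \<open>exp ((2 M + c) (C p z + D))\<close>.
\<close>

section \<open>Invariance of Lebesgue measure under isometries\<close>

text \<open>The Jacobian factor \<open>\<bar>c\<bar> ^ DIM('a)\<close> of the affine change of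
  variables is 1. The case \<open>c = 1\<close> gives translations, \<open>c = -1\<close> point
  reflections.\<close>

lemma nn_integral_lborel_affine_unit:
  fixes f :: "'a::euclidean_space \<Rightarrow> ennreal"
  assumes [measurable]: "f \<in> borel_measurable borel" and c: "\<bar>c\<bar> = 1"
  shows "(\<integral>\<^sup>+x. f (t + c *\<^sub>R x) \<partial>lborel) = (\<integral>\<^sup>+x. f x \<partial>lborel)"
proof -
  have "c \<noteq> 0" using c by auto
  then have "(\<integral>\<^sup>+x. f x \<partial>lborel) =
    (\<integral>\<^sup>+x. f x \<partial>density (distr lborel borel (\<lambda>x. t + c *\<^sub>R x)) (\<lambda>_. \<bar>c\<bar> ^ DIM('a)))"
    by (subst lborel_affine[of c t]) auto
  also have "\<dots> = (\<integral>\<^sup>+x. f (t + c *\<^sub>R x) \<partial>lborel)"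
    by (simp add: c nn_integral_density nn_integral_distr)
  finally show ?thesis by simp
qed

text \<open>
  Uniqueness of Haar measure in miniature: Fubini's theorem and invariance under translations and
  \<open>x \<mapsto> - x\<close> give \<open>\<nu> A * \<lambda> B = \<lambda> A * \<nu> B\<close> for the image measure \<open>\<nu>\<close>, and \<open>\<nu> B = \<lambda> B\<close> for the unit ball.
\<close>
lemma distr_lborel_orthogonal_transformation:
  fixes T :: "'a::euclidean_space \<Rightarrow> 'a"
  assumes T: "orthogonal_transformation T"
  shows "distr lborel borel T = lborel"
proof (rule measure_eqI)
  fix A assume "A \<in> sets (distr lborel borel T)"
  then have [measurable]: "A \<in> sets borel" by simp
  have lin: "linear T" using T by (rule orthogonal_transformation_linear)
  have [measurable]: "T \<in> borel_measurable borel"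
    using lin by (intro borel_measurable_continuous_onI linear_continuous_on linear_linear[THEN iffD2])
  define B :: "'a set" where "B = ball 0 1"
  have [measurable]: "B \<in> sets borel" by (simp add: B_def)
  have TB: "T x \<in> B \<longleftrightarrow> x \<in> B" for x
    using T by (simp add: B_def orthogonal_transformation_norm)
  let ?i = "\<lambda>S x. indicator S x :: ennreal"
  have "emeasure (distr lborel borel T) A * emeasure lborel B
      = (\<integral>\<^sup>+x. ?i A (T x) \<partial>lborel) * (\<integral>\<^sup>+y. ?i B y \<partial>lborel)"
    by (simp add: nn_integral_distr[of T lborel borel "?i A", symmetric])
  also have "\<dots> = (\<integral>\<^sup>+x. \<integral>\<^sup>+y. ?i A (T x) * ?i B y \<partial>lborel \<partial>lborel)"
    by (simp add: nn_integral_cmult nn_integral_multc)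
  also have "\<dots> = (\<integral>\<^sup>+x. \<integral>\<^sup>+y. ?i A (T x) * ?i B (T x + y) \<partial>lborel \<partial>lborel)"
    using nn_integral_lborel_affine_unit[of "?i B" 1]
    by (simp add: nn_integral_cmult)
  also have "\<dots> = (\<integral>\<^sup>+y. \<integral>\<^sup>+x. ?i A (T x) * ?i B (T x + y) \<partial>lborel \<partial>lborel)"
    by (rule lborel_pair.Fubini') measurable
  also have "\<dots> = (\<integral>\<^sup>+y. \<integral>\<^sup>+x. ?i A (T x - y) * ?i B (T x) \<partial>lborel \<partial>lborel)"
  proof (rule nn_integral_cong)
    fix y
    \<comment> \<open>Since \<open>T (x - z) = T x - y\<close>, the substitution
      \<open>x \<mapsto> x - z\<close> moves the shift by \<open>y\<close> from the factor for
      \<open>B\<close> to the factor for \<open>A\<close>.\<close>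
    obtain z where z: "y = T z"
      using T orthogonal_transformation_surj by blast
    show "(\<integral>\<^sup>+x. ?i A (T x) * ?i B (T x + y) \<partial>lborel) = (\<integral>\<^sup>+x. ?i A (T x - y) * ?i B (T x) \<partial>lborel)"
      using nn_integral_lborel_affine_unit[of "\<lambda>x. ?i A (T x) * ?i B (T x + y)" 1 "- z"]
      by (simp add: z linear_add[OF lin] linear_diff[OF lin] linear_neg[OF lin])
  qed
  also have "\<dots> = (\<integral>\<^sup>+x. \<integral>\<^sup>+y. ?i A (T x - y) * ?i B (T x) \<partial>lborel \<partial>lborel)"
    by (rule lborel_pair.Fubini') measurable
  \<comment> \<open>For fixed \<open>x\<close> the reflection \<open>y \<mapsto> T x - y\<close>
    preserves the measure, so the inner integral no longer depends on \<open>x\<close> through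
    \<open>A\<close>.\<close>
  also have "\<dots> = (\<integral>\<^sup>+x. emeasure lborel A * ?i B (T x) \<partial>lborel)"
    using nn_integral_lborel_affine_unit[of "?i A" "-1"]
    by (simp add: nn_integral_multc)
  also have "\<dots> = emeasure lborel A * emeasure lborel B"
    by (simp add: nn_integral_cmult indicator_def TB flip: nn_integral_indicator)
  finally have eq: "emeasure (distr lborel borel T) A * emeasure lborel B = emeasure lborel A * emeasure lborel B" .
  \<comment> \<open>The factor for \<open>B\<close> can be cancelled in \<open>ennreal\<close>
    because it is neither 0 nor infinite.\<close>
  have "emeasure lborel B = ennreal (measure lborel B)" "measure lborel B > 0"
    using emeasure_lborel_ball_finite[of "0::'a" 1]
    by (auto simp: B_def content_ball_pos less_top intro!: emeasure_eq_ennreal_measure)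
  with eq show "emeasure (distr lborel borel T) A = emeasure lborel A"
    by (metis ennreal_eq_0_iff ennreal_mult_cancel_left ennreal_neq_top mult.commute not_le)
qed simp

section \<open>An integrable majorant on the plane\<close>

text \<open>With \<open>z = x + i y\<close>, the integrand is dominated by the product of
  \<open>1 / (1 + x^2)\<close> and \<open>1 / (1 + y^2)\<close>, so the integral is at most the
  square of a finite one over the real line.\<close>

lemma nn_integral_inverse_1_plus_square_sq_finite:
  "(\<integral>\<^sup>+z. ennreal (1 / (1 + (cmod z)\<^sup>2)\<^sup>2) \<partial>lborel) < \<infinity>"
proof -
  let ?g = "\<lambda>x::real. ennreal (inverse (1 + x\<^sup>2))"
  have "einterval (- \<infinity>) \<infinity> = UNIV" by (auto simp: einterval_def)
  with integrable_inverse_1_plus_square have "integrable lborel (\<lambda>x::real. inverse (1 + x\<^sup>2))"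
    by (simp add: set_integrable_def)
  then have fin: "(\<integral>\<^sup>+x. ?g x \<partial>lborel) < \<infinity>"
    by (simp add: integrable_iff_bounded)
  have "(\<integral>\<^sup>+z. ennreal (1 / (1 + (cmod z)\<^sup>2)\<^sup>2) \<partial>lborel)
      \<le> (\<integral>\<^sup>+z. (\<Prod>b\<in>Basis. ?g ((z::complex) \<bullet> b)) \<partial>lborel)"
  proof (rule nn_integral_mono)
    fix z :: complex
    let ?x = "(Re z)\<^sup>2" and ?y = "(Im z)\<^sup>2"
    have "1 / (1 + (cmod z)\<^sup>2)\<^sup>2 \<le> 1 / ((1 + ?x) * (1 + ?y))"
    proof (rule divide_left_mono)
      have "(1 + (?x + ?y))\<^sup>2 = (1 + ?x) * (1 + ?y) + (?x + ?y + ?x * ?y + ?x\<^sup>2 + ?y\<^sup>2)"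
        by (simp add: power2_eq_square algebra_simps)
      then show "(1 + ?x) * (1 + ?y) \<le> (1 + (cmod z)\<^sup>2)\<^sup>2"
        unfolding cmod_power2 by simp
      show "0 < (1 + (cmod z)\<^sup>2)\<^sup>2 * ((1 + ?x) * (1 + ?y))"
        by (intro mult_pos_pos zero_less_power add_pos_nonneg) auto
    qed simp
    then show "ennreal (1 / (1 + (cmod z)\<^sup>2)\<^sup>2) \<le> (\<Prod>b\<in>Basis. ?g (z \<bullet> b))"
      by (simp add: Basis_complex_def ennreal_mult[symmetric] divide_inverse inverse_mult_distrib
          ennreal_leI add_nonneg_nonneg)
  qed
  also have "\<dots> = (\<Prod>b\<in>(Basis::complex set). (\<integral>\<^sup>+x. ?g x \<partial>lborel))"
    by (rule nn_integral_lborel_prod[of "\<lambda>_ x. ?g x"]) auto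
  also have "\<dots> < \<infinity>"
    using fin by (simp add: ennreal_mult_less_top power2_eq_square)
  finally show ?thesis .
qed

section \<open>Mean value inequalities on circles and discs\<close>

text \<open>Cauchy's integral formula at the centre, with the norm taken inside the integral. The
  unit circle suffices: other centres and radii come from applying this to
  \<open>u \<mapsto> h (z + u * w)\<close>.\<close>

lemma norm_le_nn_integral_circle:
  assumes "h holomorphic_on UNIV"
  shows "ennreal (cmod (h 0)) \<le> (\<integral>\<^sup>+t. ennreal (cmod (h (cis (2 * pi * t)))) * indicator {0..1} t \<partial>lborel)"
proof -
  have cont: "continuous_on UNIV h"
    using assms by (rule holomorphic_on_imp_continuous_on)
  have hc: "continuous_on {0..1} (\<lambda>t. h (cis (2 * pi * t)))"
    by (intro continuous_on_compose2[OF cont] continuous_intros) auto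
  have "((\<lambda>u. h u / (u - 0)) has_contour_integral (2 * of_real pi * \<i> * h 0)) (circlepath 0 1)"
    using assms by (intro Cauchy_integral_circlepath_simple) (auto intro: holomorphic_on_subset)
  then have "((\<lambda>t. 2 * of_real pi * \<i> * h (cis (2 * pi * t))) has_integral 2 * of_real pi * \<i> * h 0) {0..1}"
    unfolding has_contour_integral_def
  proof (rule has_integral_eq[rotated])
    \<comment> \<open>The derivative of the circle path is \<open>2 * pi * \<i>\<close> times the
      path itself, which cancels the denominator of the Cauchy kernel.\<close>
    fix t :: real assume "t \<in> {0..1}"
    then have "vector_derivative (circlepath 0 1) (at t within {0..1}) = 2 * of_real pi * \<i> * cis (2 * pi * t)"
      by (simp add: vector_derivative_circlepath01 cis_conv_exp mult_ac)
    moreover have "circlepath 0 1 t = cis (2 * pi * t)"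
      by (simp add: circlepath cis_conv_exp mult_ac)
    ultimately show "h (circlepath 0 1 t) / (circlepath 0 1 t - 0) * vector_derivative (circlepath 0 1) (at t within {0..1})
        = 2 * of_real pi * \<i> * h (cis (2 * pi * t))"
      by simp
  qed
  then have "((\<lambda>t. h (cis (2 * pi * t))) has_integral h 0) {0..1}"
    by (subst (asm) has_integral_mult_right_iff) auto
  moreover have int: "(\<lambda>t. cmod (h (cis (2 * pi * t)))) integrable_on {0..1}"
    by (intro integrable_continuous_real continuous_on_norm hc)
  ultimately have "cmod (h 0) \<le> integral {0..1} (\<lambda>t. cmod (h (cis (2 * pi * t))))"
    using integral_norm_bound_integral by (metis (no_types, lifting) has_integral_iff order_refl)
  also have "ennreal \<dots> = (\<integral>\<^sup>+t. ennreal (cmod (h (cis (2 * pi * t)))) * indicator {0..1} t \<partial>lborel)"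
    using int by (intro nn_integral_has_integral_lebesgue'[symmetric] integrable_integral) auto
  finally show ?thesis by (simp add: ennreal_leI)
qed

text \<open>
  Averaging the disc integral over all rotations about the centre reduces this to the mean value
  inequality on circles, without polar coordinates.
\<close>
lemma norm_le_nn_integral_disc:
  assumes h: "h holomorphic_on UNIV"
  shows "ennreal (cmod (h z)) * emeasure lborel (cball (0::complex) 1)
    \<le> (\<integral>\<^sup>+w. ennreal (cmod (h w)) * indicator (cball z 1) w \<partial>lborel)"
proof -
  let ?B = "cball (0::complex) 1"
  let ?F = "\<lambda>w. ennreal (cmod (h (z + w))) * indicator ?B w"
  have cont: "continuous_on UNIV h"
    using h by (rule holomorphic_on_imp_continuous_on)
  then have [measurable]: "h \<in> borel_measurable borel"
    by (rule borel_measurable_continuous_onI)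
  have [measurable]: "(\<lambda>t::real. cis (2 * pi * t)) \<in> borel_measurable borel"
    by (intro borel_measurable_continuous_onI continuous_intros)
  have [measurable]: "?B \<in> sets borel"
    by simp
  have [measurable]: "?F \<in> borel_measurable borel"
    by measurable
  have rot: "(\<integral>\<^sup>+w. ?F (cis s * w) \<partial>lborel) = (\<integral>\<^sup>+w. ?F w \<partial>lborel)" for s
  proof -
    have "orthogonal_transformation (\<lambda>w. cis s * w)"
      unfolding orthogonal_transformation
      by (auto simp: norm_mult linear_iff algebra_simps)
    from distr_lborel_orthogonal_transformation[OF this]
    have "(\<integral>\<^sup>+w. ?F w \<partial>lborel) = (\<integral>\<^sup>+w. ?F w \<partial>distr lborel borel (\<lambda>w. cis s * w))"
      by simp
    also have "\<dots> = (\<integral>\<^sup>+w. ?F (cis s * w) \<partial>lborel)"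
      by (rule nn_integral_distr) measurable
    finally show ?thesis by simp
  qed
  have "ennreal (cmod (h z)) * emeasure lborel ?B = (\<integral>\<^sup>+w. ennreal (cmod (h z)) * indicator ?B w \<partial>lborel)"
    by (simp add: nn_integral_cmult)
  also have "\<dots> \<le> (\<integral>\<^sup>+w. \<integral>\<^sup>+t. ?F (cis (2 * pi * t) * w) * indicator {0..1} t \<partial>lborel \<partial>lborel)"
  proof (rule nn_integral_mono)
    fix w :: complex
    \<comment> \<open>This function takes the value \<open>h z\<close> at 0, and on the unit circle
      it samples \<open>h\<close> on the circle of radius \<open>cmod w\<close> about
      \<open>z\<close>. The indicator of the disc depends only on \<open>cmod w\<close>, so it is
      unaffected by the rotation.\<close>
    have "(\<lambda>u. h (z + u * w)) holomorphic_on UNIV"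
      by (intro holomorphic_on_compose_gen[OF _ h, unfolded o_def] holomorphic_intros) auto
    from norm_le_nn_integral_circle[OF this]
    show "ennreal (cmod (h z)) * indicator ?B w
        \<le> (\<integral>\<^sup>+t. ?F (cis (2 * pi * t) * w) * indicator {0..1} t \<partial>lborel)"
      by (auto simp: indicator_def norm_mult)
  qed
  also have "\<dots> = (\<integral>\<^sup>+t. \<integral>\<^sup>+w. ?F (cis (2 * pi * t) * w) * indicator {0..1} t \<partial>lborel \<partial>lborel)"
    by (rule lborel_pair.Fubini') measurable
  \<comment> \<open>By \<open>rot\<close> the integral over \<open>w\<close> is the same for every
    angle, and the angles are averaged over an interval of length 1.\<close>
  also have "\<dots> = (\<integral>\<^sup>+t. (\<integral>\<^sup>+w. ?F w \<partial>lborel) * indicator {0..1::real} t \<partial>lborel)"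
    by (intro nn_integral_cong, subst nn_integral_multc) (measurable, simp only: rot)
  also have "\<dots> = (\<integral>\<^sup>+w. ?F w \<partial>lborel)"
    by (simp add: nn_integral_cmult)
  also have "\<dots> = (\<integral>\<^sup>+w. ennreal (cmod (h w)) * indicator (cball z 1) w \<partial>lborel)"
    using nn_integral_lborel_affine_unit[of "\<lambda>w. ennreal (cmod (h w)) * indicator (cball z 1) w" 1 z]
    by (simp add: indicator_def dist_norm)
  finally show ?thesis .
qed

section \<open>The two inclusions\<close>

lemma A_space_subset_H_space: "A_space p \<subseteq> H_space p"
proof
  fix f assume "f \<in> A_space p"
  then obtain A B where f: "f holomorphic_on UNIV" and AB: "A > 0" "B > 0"
    and le: "\<And>z. cmod (f z) \<le> A * exp (B * p z)"
    by (auto simp: A_space_def)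
  have "(\<integral>\<^sup>+z. ennreal ((cmod (f z))\<^sup>2 / (1 + (cmod z)\<^sup>2)\<^sup>2 * exp (- (2 * B) * p z)) \<partial>lborel)
      \<le> (\<integral>\<^sup>+z. ennreal (A\<^sup>2) * ennreal (1 / (1 + (cmod z)\<^sup>2)\<^sup>2) \<partial>lborel)"
  proof (rule nn_integral_mono)
    fix z
    have "(cmod (f z))\<^sup>2 * exp (- (2 * B) * p z) \<le> (A * exp (B * p z))\<^sup>2 * exp (- (2 * B) * p z)"
      by (intro mult_right_mono power_mono le) auto
    also have "\<dots> = A\<^sup>2"
      by (simp add: power_mult_distrib exp_double[symmetric] mult_ac flip: exp_add)
    finally have "(cmod (f z))\<^sup>2 / (1 + (cmod z)\<^sup>2)\<^sup>2 * exp (- (2 * B) * p z) \<le> A\<^sup>2 * (1 / (1 + (cmod z)\<^sup>2)\<^sup>2)"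
      by (simp add: divide_right_mono)
    then show "ennreal ((cmod (f z))\<^sup>2 / (1 + (cmod z)\<^sup>2)\<^sup>2 * exp (- (2 * B) * p z))
        \<le> ennreal (A\<^sup>2) * ennreal (1 / (1 + (cmod z)\<^sup>2)\<^sup>2)"
      by (simp add: ennreal_leI flip: ennreal_mult)
  qed
  also have "\<dots> = ennreal (A\<^sup>2) * (\<integral>\<^sup>+z. ennreal (1 / (1 + (cmod z)\<^sup>2)\<^sup>2) \<partial>lborel)"
    by (rule nn_integral_cmult) measurable
  also have "\<dots> < \<infinity>"
    using nn_integral_inverse_1_plus_square_sq_finite by (simp add: ennreal_mult_less_top)
  finally show "f \<in> H_space p"
    using f AB by (auto simp: H_space_def intro!: exI[of _ "2 * B"])
qed

lemma H_space_subset_A_space: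
  assumes "M > 0" and log_le: "\<And>z. ln (1 + (cmod z)\<^sup>2) \<le> M * p z"
    and "C > 0" and slow: "\<And>z w. cmod (z - w) \<le> 1 \<Longrightarrow> p z \<le> C * p w + D"
  shows "H_space p \<subseteq> A_space p"
proof
  fix f assume "f \<in> H_space p"
  then obtain c where f: "f holomorphic_on UNIV" and "c > 0"
    and fin: "(\<integral>\<^sup>+z. ennreal ((cmod (f z))\<^sup>2 / (1 + (cmod z)\<^sup>2)\<^sup>2 * exp (- c * p z)) \<partial>lborel) < \<infinity>"
    by (auto simp: H_space_def)
  let ?g = "\<lambda>z. (cmod (f z))\<^sup>2 / (1 + (cmod z)\<^sup>2)\<^sup>2 * exp (- c * p z)"
  obtain I where I: "I \<ge> 0" "(\<integral>\<^sup>+z. ennreal (?g z) \<partial>lborel) = ennreal I"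
    using fin by (auto simp: less_top elim: ennreal_cases)
  have [measurable]: "cball z 1 \<in> sets borel" for z :: complex
    by simp
  have [measurable]: "f \<in> borel_measurable borel"
    using f by (intro borel_measurable_continuous_onI holomorphic_on_imp_continuous_on)
  define V where "V = measure lborel (cball (0::complex) 1)"
  have V: "V > 0" "emeasure lborel (cball (0::complex) 1) = ennreal V"
    using emeasure_lborel_cball_finite[of "0::complex" 1]
    by (auto simp: V_def content_cball_pos less_top intro!: emeasure_eq_ennreal_measure)
  \<comment> \<open>The part \<open>2 * M\<close> absorbs
    \<open>(1 + (cmod w)\<^sup>2)\<^sup>2\<close> through the logarithmic bound, and
    \<open>c\<close> undoes the exponential weight.\<close>
  define K where "K = 2 * M + c"
  have "K > 0" using \<open>M > 0\<close> \<open>c > 0\<close> by (simp add: K_def)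
  have sq: "(cmod (f z))\<^sup>2 \<le> I / V * exp (K * (C * p z + D))" for z
  proof -
    let ?E = "exp (K * (C * p z + D))"
    have weight: "(cmod (f w))\<^sup>2 \<le> ?E * ?g w" if "w \<in> cball z 1" for w
    proof -
      have pos: "1 + (cmod w)\<^sup>2 > 0" by (simp add: add_pos_nonneg)
      have "(1 + (cmod w)\<^sup>2)\<^sup>2 = exp (ln (1 + (cmod w)\<^sup>2) * 2)"
        using pos by (simp add: exp_double mult.commute[of _ 2])
      also have "\<dots> \<le> exp (2 * M * p w)"
        using log_le[of w] by simp
      finally have "(1 + (cmod w)\<^sup>2)\<^sup>2 * exp (c * p w) \<le> exp (2 * M * p w) * exp (c * p w)"
        by simp
      also have "\<dots> = exp (K * p w)"
        by (simp add: K_def algebra_simps flip: exp_add)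
      also have "\<dots> \<le> ?E"
        using slow[of w z] that \<open>K > 0\<close> by (simp add: dist_norm norm_minus_commute)
      finally have "(1 + (cmod w)\<^sup>2)\<^sup>2 * exp (c * p w) * ?g w \<le> ?E * ?g w"
        by (rule mult_right_mono) simp
      moreover have "(1 + (cmod w)\<^sup>2)\<^sup>2 * exp (c * p w) * ?g w = (cmod (f w))\<^sup>2"
        using pos by (simp add: exp_minus)
      ultimately show ?thesis by simp
    qed
    \<comment> \<open>The disc inequality is applied to the square of \<open>f\<close>, whose
      modulus is the numerator of the weighted integrand.\<close>
    have "(\<lambda>z. (f z)\<^sup>2) holomorphic_on UNIV"
      using f by (intro holomorphic_intros)
    from norm_le_nn_integral_disc[OF this, of z]
    have "ennreal ((cmod (f z))\<^sup>2 * V) \<le> (\<integral>\<^sup>+w. ennreal ((cmod (f w))\<^sup>2) * indicator (cball z 1) w \<partial>lborel)"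
      using V by (simp add: norm_power ennreal_mult)
    \<comment> \<open>\<open>?E\<close> depends on the centre \<open>z\<close> only, so it passes
      through the integral. Dividing by it makes the integrand at most \<open>?g w\<close>, whose
      integral is \<open>I\<close> for every \<open>z\<close>.\<close>
    then have "ennreal (1 / ?E) * ennreal ((cmod (f z))\<^sup>2 * V)
        \<le> ennreal (1 / ?E) * (\<integral>\<^sup>+w. ennreal ((cmod (f w))\<^sup>2) * indicator (cball z 1) w \<partial>lborel)"
      by (rule mult_left_mono) simp
    also have "\<dots> = (\<integral>\<^sup>+w. ennreal (1 / ?E) * (ennreal ((cmod (f w))\<^sup>2) * indicator (cball z 1) w) \<partial>lborel)"
      by (rule nn_integral_cmult[symmetric]) measurable
    also have "\<dots> \<le> (\<integral>\<^sup>+w. ennreal (?g w) \<partial>lborel)"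
    proof (rule nn_integral_mono)
      fix w
      show "ennreal (1 / ?E) * (ennreal ((cmod (f w))\<^sup>2) * indicator (cball z 1) w) \<le> ennreal (?g w)"
      proof (cases "w \<in> cball z 1")
        case True
        have "1 / ?E * (cmod (f w))\<^sup>2 \<le> ?g w"
          using weight[OF True] by (simp add: pos_divide_le_eq mult.commute)
        with True show ?thesis
          by (simp add: ennreal_leI flip: ennreal_mult)
      qed simp
    qed
    finally have "1 / ?E * ((cmod (f z))\<^sup>2 * V) \<le> I"
      using I V by (simp add: ennreal_le_iff flip: ennreal_mult)
    then show ?thesis using V by (simp add: field_simps)
  qed
  \<comment> \<open>The summand 1 keeps \<open>A\<close> positive when \<open>I = 0\<close>.\<close>
  define A where "A = sqrt (I / V * exp (K * D)) + 1"
  show "f \<in> A_space p"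
  proof -
    have "cmod (f z) \<le> A * exp (K * C / 2 * p z)" for z
    proof -
      \<comment> \<open>The exponent is split so that the square root halves \<open>K * C\<close>,
        while the constant \<open>exp (K * D)\<close> goes into \<open>A\<close>.\<close>
      have "exp (K * (C * p z + D)) = exp (K * D) * (exp (K * C / 2 * p z))\<^sup>2"
        unfolding exp_double[symmetric] exp_add[symmetric] by (simp add: algebra_simps)
      with sq[of z] have "cmod (f z) \<le> sqrt (I / V * exp (K * D) * (exp (K * C / 2 * p z))\<^sup>2)"
        by (intro real_le_rsqrt) (simp add: mult.assoc)
      also have "\<dots> \<le> A * exp (K * C / 2 * p z)"
        by (subst real_sqrt_mult[of "I / V * exp (K * D)"]) (simp add: A_def distrib_right)
      finally show ?thesis .
    qed
    moreover have "A > 0"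
      using I V by (simp add: A_def add_nonneg_pos)
    moreover have "K * C / 2 > 0"
      using \<open>K > 0\<close> \<open>C > 0\<close> by simp
    ultimately show ?thesis
      using f unfolding A_space_def by blast
  qed
qed

theorem theorem3p13:
  fixes p :: "complex \<Rightarrow> real"
  assumes "subharmonic p"
    and "\<forall>z. p z \<ge> 0"
    and "\<exists>M>0. \<forall>z. ln (1 + (cmod z)\<^sup>2) \<le> M * p z"
    and "\<exists>C>0. \<exists>D>0. \<forall>z w. cmod (z - w) \<le> 1 \<longrightarrow> p z \<le> C * p w + D"
  shows "(\<forall>f. f holomorphic_on UNIV \<longrightarrow> (f \<in> A_space p \<longleftrightarrow> f \<in> H_space p)) \<and>
         A_space p = H_space p"
proof -
  obtain M where "M > 0" "\<And>z. ln (1 + (cmod z)\<^sup>2) \<le> M * p z"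
    using assms(3) by blast
  moreover obtain C D where "C > 0" "\<And>z w. cmod (z - w) \<le> 1 \<Longrightarrow> p z \<le> C * p w + D"
    using assms(4) by blast
  ultimately have "H_space p \<subseteq> A_space p"
    by (rule H_space_subset_A_space)
  with A_space_subset_H_space[of p] show ?thesis by blast
qed

end
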